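(* Let $G=(X,E)$ be a connected $P_4$-free graph of any cardinality. If there exists $x\in X$ such that the induced subgraph $G_{\restriction \mathrm{inc}(x)}$ has finitely many connected components, then the complement graph $\overline{G}$ is not connected.
   Context: Graphs are undirected, simple, without loops, and not necessarily finite: $G=(X,E)$ with $E\subseteq [X]^2$, the set of $2$-element subsets of $X$. The complement $\overline{G}$ has vertex set $X$ and edge set $[X]^2\setminus E$. For $A\subseteq X$, $G_{\restriction A}:=(A,E\cap[A]^2)$ is the subgraph induced by $G$ on $A$. $P_4$ is the path on four vertices $1,2,3,4$ with edges $\{1,2\},\{2,3\},\{3,4\}$; a graph is $P_4$-free if it has no $P_4$ as an induced subgraph. For $x\in X$, let $N(x):=\{y\in X:\{x,y\}\in E\}$ and $\mathrm{inc}(x):=X\setminus(N(x)\cup\{x\})$.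
   Formalization: The formal statement assumes that G has at least two vertices; the one-vertex graph is connected and P_4-free with inc(x) empty, but its complement is connected, so the claim fails there. *)

theory Defs
  imports "HOL-Library.Ramsey"
begin

type_synonym 'a ugraph = "'a set \<times> 'a set set"

abbreviation verts :: "'a ugraph \<Rightarrow> 'a set" where
  "verts \<equiv> fst"

abbreviation edges :: "'a ugraph \<Rightarrow> 'a set set" where
  "edges \<equiv> snd"

definition simple_ugraph :: "'a ugraph \<Rightarrow> bool" where
  "simple_ugraph G \<longleftrightarrow> edges G \<subseteq> [verts G]\<^bsup>2\<^esup>"

definition complement_graph :: "'a ugraph \<Rightarrow> 'a ugraph" where
  "complement_graph G = (verts G, [verts G]\<^bsup>2\<^esup> - edges G)"

definition induced_graph :: "'a ugraph \<Rightarrow> 'a set \<Rightarrow> 'a ugraph" where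
  "induced_graph G A = (A, edges G \<inter> [A]\<^bsup>2\<^esup>)"

definition neighbours :: "'a ugraph \<Rightarrow> 'a \<Rightarrow> 'a set" where
  "neighbours G x = {y \<in> verts G. {x, y} \<in> edges G}"

definition inc :: "'a ugraph \<Rightarrow> 'a \<Rightarrow> 'a set" where
  "inc G x = verts G - (neighbours G x \<union> {x})"

definition graph_iso :: "'a ugraph \<Rightarrow> 'b ugraph \<Rightarrow> bool" where
  "graph_iso G H \<longleftrightarrow>
    (\<exists>f. bij_betw f (verts G) (verts H) \<and>
      (\<forall>u \<in> verts G. \<forall>v \<in> verts G. {u, v} \<in> edges G \<longleftrightarrow> {f u, f v} \<in> edges H))"

definition P4 :: "nat ugraph" where
  "P4 = ({1, 2, 3, 4}, {{1, 2}, {2, 3}, {3, 4}})"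

definition P4_free :: "'a ugraph \<Rightarrow> bool" where
  "P4_free G \<longleftrightarrow> \<not> (\<exists>A \<subseteq> verts G. graph_iso (induced_graph G A) P4)"

text \<open>Two vertices are joined by a path iff they are related by the reflexive transitive
  closure of adjacency.\<close>

definition reachable :: "'a ugraph \<Rightarrow> 'a \<Rightarrow> 'a \<Rightarrow> bool" where
  "reachable G = (\<lambda>u v. {u, v} \<in> edges G)\<^sup>*\<^sup>*"

definition connected_graph :: "'a ugraph \<Rightarrow> bool" where
  "connected_graph G \<longleftrightarrow> (\<forall>u \<in> verts G. \<forall>v \<in> verts G. reachable G u v)"

text \<open>Connected components are represented by their vertex sets; a graph without vertices
  has none.\<close>

definition graph_components :: "'a ugraph \<Rightarrow> 'a set set" where
  "graph_components G = verts G // {(u, v). u \<in> verts G \<and> v \<in> verts G \<and> reachable G u v}"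

end

theory Submission
  imports Defs
begin

text \<open>For \<open>z \<in> inc(x)\<close> let \<open>S(z) = N(z) \<inter> N(x)\<close>. As \<open>G\<close> is \<open>P\<^sub>4\<close>-free,
  \<open>S\<close> is constant on the components of \<open>inc(x)\<close> and any two of its values are comparable; as \<open>G\<close>
  is connected, no value is empty. Since there are finitely many components, there is a least
  value, so some vertex of \<open>N(x)\<close> is adjacent to all of \<open>inc(x)\<close>. The set of all such vertices is
  completely joined to its complement, again by \<open>P\<^sub>4\<close>-freeness, and it does not contain \<open>x\<close>.\<close>

lemma edge_in_verts:
  assumes "simple_ugraph G" "{u, v} \<in> edges G"
  shows "u \<in> verts G" "v \<in> verts G" "u \<noteq> v"
proof -
  have "{u, v} \<in> [verts G]\<^bsup>2\<^esup>"
    using assms unfolding simple_ugraph_def by blast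
  then show "u \<in> verts G" "v \<in> verts G" "u \<noteq> v"
    by (auto simp: nsets_def)
qed

text \<open>This is the form in which \<open>P4_free\<close> gets used. Distinctness of
  \<open>a\<close>, \<open>b\<close>, \<open>c\<close>, \<open>d\<close> need not be assumed:
  identifying two of them would turn a required non-edge into an edge or create a loop.\<close>

lemma P4_freeD:
  assumes G: "simple_ugraph G" and free: "P4_free G"
    and ab: "{a, b} \<in> edges G" and bc: "{b, c} \<in> edges G" and cd: "{c, d} \<in> edges G"
    and ac: "{a, c} \<notin> edges G" and bd: "{b, d} \<notin> edges G" and ad: "{a, d} \<notin> edges G"
  shows False
proof -
  have distinct: "a \<noteq> b" "b \<noteq> c" "c \<noteq> d" "a \<noteq> c" "b \<noteq> d" "a \<noteq> d"
    using edge_in_verts(3)[OF G] ab bc cd ac bd ad by (auto simp: insert_commute)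
  \<comment> \<open>The isomorphism condition also ranges over equal vertices, where
    \<open>{u, v}\<close> collapses to a singleton.\<close>
  have no_loop: "{u} \<notin> edges G" for u
    using edge_in_verts(3)[OF G, of u u] by auto
  define f :: "'a \<Rightarrow> nat" where
    "f v = (if v = a then 1 else if v = b then 2 else if v = c then 3 else 4)" for v
  have f: "f a = 1" "f b = 2" "f c = 3" "f d = 4"
    using distinct by (auto simp: f_def)
  have sym: "{b, a} = {a, b}" "{c, b} = {b, c}" "{d, c} = {c, d}"
    "{c, a} = {a, c}" "{d, b} = {b, d}" "{d, a} = {a, d}"
    by auto
  have "bij_betw f {a, b, c, d} {1, 2, 3, 4}"
    using distinct by (auto simp: bij_betw_def f)
  moreover have "{u, v} \<in> edges (induced_graph G {a, b, c, d}) \<longleftrightarrow> {f u, f v} \<in> edges P4"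
    if "u \<in> {a, b, c, d}" "v \<in> {a, b, c, d}" for u v
    using that distinct ab bc cd ac bd ad no_loop
    by (elim insertE emptyE)
       (simp_all add: f P4_def induced_graph_def sym doubleton_eq_iff)
  ultimately have "graph_iso (induced_graph G {a, b, c, d}) P4"
    unfolding graph_iso_def by (intro exI[of _ f]) (auto simp: induced_graph_def P4_def)
  moreover have "{a, b, c, d} \<subseteq> verts G"
    using edge_in_verts[OF G ab] edge_in_verts[OF G cd] by auto
  ultimately show False
    using free unfolding P4_free_def by blast
qed

text \<open>A function that is constant along edges is constant on components, so its values at one
  chosen representative per component already exhaust its image.\<close>

lemma finite_image_if_finite_components:
  assumes fin: "finite (graph_components H)"
    and const: "\<And>u v. {u, v} \<in> edges H \<Longrightarrow> f u = f v"
  shows "finite (f ` verts H)"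
proof -
  let ?R = "{(u, v). u \<in> verts H \<and> v \<in> verts H \<and> reachable H u v}"
  have reach: "f v = f u" if "reachable H u v" for u v
    using that unfolding reachable_def by induction (auto dest: const)
  have "f ` verts H \<subseteq> (\<lambda>C. f (SOME v. v \<in> C)) ` graph_components H"
  proof (rule image_subsetI)
    fix u assume u: "u \<in> verts H"
    have "u \<in> ?R `` {u}"
      using u by (simp add: reachable_def)
    then have "(SOME v. v \<in> ?R `` {u}) \<in> ?R `` {u}"
      by (rule someI)
    then have "f (SOME v. v \<in> ?R `` {u}) = f u"
      using reach by blast
    moreover have "?R `` {u} \<in> graph_components H"
      using u unfolding graph_components_def by (rule quotientI)
    ultimately show "f u \<in> (\<lambda>C. f (SOME v. v \<in> C)) ` graph_components H"
      by (intro image_eqI) simp_all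
  qed
  then show ?thesis
    using fin finite_surj by blast
qed

lemma finite_chain_least:
  assumes "finite F" "F \<noteq> {}" "\<And>A B. A \<in> F \<Longrightarrow> B \<in> F \<Longrightarrow> A \<subseteq> B \<or> B \<subseteq> A"
  obtains M where "M \<in> F" "\<And>A. A \<in> F \<Longrightarrow> M \<subseteq> A"
  using finite_has_minimal[OF assms(1,2)] assms(3) by (metis order_refl)

theorem corollary3:
  fixes G :: "'a ugraph"
  assumes "simple_ugraph G"
    and "\<exists>u \<in> verts G. \<exists>v \<in> verts G. u \<noteq> v"
    and "connected_graph G"
    and "P4_free G"
    and "\<exists>x \<in> verts G. finite (graph_components (induced_graph G (inc G x)))"
  shows "\<not> connected_graph (complement_graph G)"
proof -
  note verts = edge_in_verts[OF assms(1)]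
  note no_P4 = P4_freeD[OF assms(1,4)]
  obtain x where x: "x \<in> verts G"
    and fin: "finite (graph_components (induced_graph G (inc G x)))"
    using assms(5) by blast
  let ?N = "neighbours G x"
  define S where "S z = neighbours G z \<inter> ?N" for z
  have N_iff: "y \<in> neighbours G u \<longleftrightarrow> {u, y} \<in> edges G" for u y
    using verts by (auto simp: neighbours_def)
  have inc_iff: "z \<in> inc G x \<longleftrightarrow> z \<in> verts G \<and> z \<noteq> x \<and> {x, z} \<notin> edges G" for z
    by (auto simp: inc_def N_iff)
  have S_iff: "y \<in> S z \<longleftrightarrow> {z, y} \<in> edges G \<and> {x, y} \<in> edges G" for y z
    by (simp add: S_def N_iff)

  \<comment> \<open>If \<open>y\<close> were in \<open>S u\<close> but not in \<open>S v\<close>,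
    then x, y, u, v would be an induced path.\<close>
  have S_subset: "S u \<subseteq> S v" if "{u, v} \<in> edges G" "u \<in> inc G x" "v \<in> inc G x" for u v
  proof
    fix y assume "y \<in> S u"
    then show "y \<in> S v"
      using no_P4[of x y u v] that by (auto simp: S_iff inc_iff insert_commute)
  qed
  then have S_eq: "S u = S v" if "{u, v} \<in> edges G" "u \<in> inc G x" "v \<in> inc G x" for u v
    using that by (metis insert_commute subset_antisym)
  have S_chain: "S u \<subseteq> S v \<or> S v \<subseteq> S u" if u: "u \<in> inc G x" and v: "v \<in> inc G x" for u v
  proof (rule ccontr)
    assume "\<not> ?thesis"
    then obtain y y' where y: "y \<in> S u" "y \<notin> S v" and y': "y' \<in> S v" "y' \<notin> S u"
      by blast
    have uv: "{u, v} \<notin> edges G"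
      using S_eq[OF _ u v] y by blast
    show False
    \<comment> \<open>The induced path is u, y, y', v if y and y' are adjacent, and u, y, x, y'
      otherwise.\<close>
    proof (cases "{y, y'} \<in> edges G")
      case True
      then show False
        using no_P4[of u y y' v] y y' uv by (auto simp: S_iff insert_commute)
    next
      case False
      then show False
        using no_P4[of u y x y'] y y' u by (auto simp: S_iff inc_iff insert_commute)
    qed
  qed

  have S_nonempty: "S z \<noteq> {}" if z: "z \<in> inc G x" for z
  proof
    assume empty: "S z = {}"
    \<comment> \<open>A walk can leave \<open>inc G x\<close> only through a vertex of some
      \<open>S w\<close>. If \<open>S z\<close> is empty, a walk from \<open>z\<close> is trapped
      and never reaches \<open>x\<close>.\<close>
    have "w \<in> inc G x \<and> S w = {}" if "reachable G z w" for w
      using that unfolding reachable_def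
    proof induction
      case base
      show ?case using z empty by simp
    next
      case (step u v)
      then have "{x, v} \<notin> edges G"
        using S_iff[of v u] by simp
      then have "v \<in> inc G x"
        using step verts(2) by (auto simp: inc_iff insert_commute)
      then show ?case
        using step S_eq by blast
    qed
    moreover have "reachable G z x"
      using assms(3) x z by (simp add: connected_graph_def inc_iff)
    ultimately show False
      by (auto simp: inc_iff)
  qed
  \<comment> \<open>Here the second vertex matters: a one-vertex graph and its complement are both
    connected.\<close>
  have N_nonempty: "?N \<noteq> {}"
  proof -
    obtain u where "u \<in> verts G" "u \<noteq> x"
      using assms(2) by metis
    then show ?thesis
      using S_nonempty[of u] by (auto simp: inc_def S_def)
  qed

  define T where "T = {y \<in> ?N. \<forall>z \<in> inc G x. {z, y} \<in> edges G}"
  have "finite (S ` inc G x)"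
    using finite_image_if_finite_components[OF fin, of S] S_eq
    by (auto simp: induced_graph_def)
  have "T \<noteq> {}"
  proof (cases "inc G x = {}")
    case True
    then show ?thesis using N_nonempty by (simp add: T_def)
  next
    case False
    \<comment> \<open>A vertex of the least value \<open>M\<close> lies in every \<open>S z\<close>,
      hence is adjacent to all of \<open>inc G x\<close>.\<close>
    obtain M where "M \<in> S ` inc G x" "\<And>A. A \<in> S ` inc G x \<Longrightarrow> M \<subseteq> A"
      using finite_chain_least[OF \<open>finite (S ` inc G x)\<close>] False S_chain by blast
    moreover from this obtain y where "y \<in> M"
      using S_nonempty by blast
    ultimately have "y \<in> T"
      by (force simp: T_def S_iff N_iff)
    then show ?thesis by blast
  qed
  then obtain t where t: "t \<in> T" by blast

  have T_joined: "{y, w} \<in> edges G" if y: "y \<in> T" and w: "w \<in> verts G" "w \<notin> T" for y w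
  proof -
    consider "w = x" | "w \<in> inc G x" | "w \<in> ?N"
      using w by (auto simp: inc_def)
    then show ?thesis
    proof cases
      case 3
      \<comment> \<open>The vertex \<open>z\<close> witnesses that \<open>w\<close> is not in
        \<open>T\<close>. Were \<open>y\<close> and \<open>w\<close> not adjacent, z, y, x, w would
        be an induced path.\<close>
      then obtain z where z: "z \<in> inc G x" "{z, w} \<notin> edges G"
        using w by (auto simp: T_def)
      moreover have "{z, y} \<in> edges G" "{y, x} \<in> edges G"
        using y z by (auto simp: T_def N_iff insert_commute)
      ultimately show ?thesis
        using no_P4[of z y x w] 3 by (auto simp: N_iff inc_iff insert_commute)
    qed (use y in \<open>auto simp: T_def N_iff insert_commute\<close>)
  qed
  show ?thesis
  proof
    assume "connected_graph (complement_graph G)"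
    then have "reachable (complement_graph G) t x"
      using t x by (auto simp: connected_graph_def complement_graph_def T_def neighbours_def)
    \<comment> \<open>No edge of the complement leaves \<open>T\<close>, so membership in
      \<open>T\<close> propagates from \<open>t\<close> along the walk.\<close>
    then have "x \<in> T"
      unfolding reachable_def
    proof induction
      case (step u v)
      then show ?case using T_joined by (auto simp: complement_graph_def)
    qed (rule t)
    then show False
      using verts(3)[of x x] by (simp add: T_def N_iff)
  qed
qed

end
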